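(* Let $k$ be a nonnegative integer and $n=2k+1$. Then $rn(C_n\square C_n)\ge \frac{n^2-1}{2}(k+1)+1$.
   Context: $C_n$ is the cycle graph with vertex set $\{0,\dots,n-1\}$, distinct $v,w$ adjacent iff $v\equiv w\pm1 \pmod n$. The Cartesian product $G\square H$ has vertex set $V(G)\times V(H)$, with $(g,h)\sim(g',h')$ iff ($g=g'$ and $hh'\in E(H)$) or ($h=h'$ and $gg'\in E(G)$). $d(u,v)$ is graph distance and $\operatorname{diam}(G)$ the maximum distance in $G$. A radio labeling of a connected graph $G$ is a function $c:V(G)\to\{1,2,\dots\}$ with $d(u,v)+|c(u)-c(v)|\ge 1+\operatorname{diam}(G)$ for all distinct $u,v$. The span of $c$ is its maximum value; $rn(G)$ is the minimum span over all radio labelings of $G$. *)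

theory Defs
  imports "Graph_Theory.Graph_Theory" "HOL-Number_Theory.Cong"
begin

text \<open>
  A finite simple graph is a \<open>pair_graph\<close> of \<open>Graph_Theory\<close>: a finite vertex set with a
  symmetric, irreflexive arc relation, so that each edge is represented by both of its orientations.
\<close>

definition cycle_graph :: "nat \<Rightarrow> nat pair_pre_digraph" where
  "cycle_graph n = \<lparr> pverts = {0..<n},
     parcs = {(v, w). v \<in> {0..<n} \<and> w \<in> {0..<n} \<and> v \<noteq> w \<and>
       ([int v = int w + 1] (mod int n) \<or> [int v = int w - 1] (mod int n))} \<rparr>"

definition cartesian_product ::
  "'a pair_pre_digraph \<Rightarrow> 'b pair_pre_digraph \<Rightarrow> ('a \<times> 'b) pair_pre_digraph"
  (infixr \<open>\<box>\<close> 70) where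
  "G \<box> H = \<lparr> pverts = pverts G \<times> pverts H,
     parcs = {((g, h), (g', h')). (g, h) \<in> pverts G \<times> pverts H \<and> (g', h') \<in> pverts G \<times> pverts H \<and>
       (g = g' \<and> (h, h') \<in> parcs H \<or> h = h' \<and> (g, g') \<in> parcs G)} \<rparr>"

text \<open>
  The length of a shortest walk. It is unspecified if no walk joins the two vertices; distance,
  diameter and radio labelings are meant for connected graphs only.
\<close>

definition graph_dist :: "'a pair_pre_digraph \<Rightarrow> 'a \<Rightarrow> 'a \<Rightarrow> nat" where
  "graph_dist G u v = (LEAST l. \<exists>p. pre_digraph.awalk (with_proj G) u p v \<and> length p = l)"

definition graph_diam :: "'a pair_pre_digraph \<Rightarrow> nat" where
  "graph_diam G = Max {graph_dist G u v | u v. u \<in> pverts G \<and> v \<in> pverts G}"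

text \<open>Only the values of a labeling on the vertex set matter.\<close>

definition radio_labeling :: "'a pair_pre_digraph \<Rightarrow> ('a \<Rightarrow> nat) \<Rightarrow> bool" where
  "radio_labeling G c \<longleftrightarrow> (\<forall>v\<in>pverts G. 1 \<le> c v) \<and>
     (\<forall>u\<in>pverts G. \<forall>v\<in>pverts G. u \<noteq> v \<longrightarrow>
        int (graph_dist G u v) + \<bar>int (c u) - int (c v)\<bar> \<ge> 1 + int (graph_diam G))"

definition label_span :: "'a pair_pre_digraph \<Rightarrow> ('a \<Rightarrow> nat) \<Rightarrow> nat" where
  "label_span G c = Max (c ` pverts G)"

definition radio_number :: "'a pair_pre_digraph \<Rightarrow> nat" where
  "radio_number G = (LEAST s. \<exists>c. radio_labeling G c \<and> label_span G c = s)"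

lemma pair_graph_cycle_graph: "pair_graph (cycle_graph n)"
proof -
  have "finite (parcs (cycle_graph n))"
    by (rule finite_subset[of _ "{0..<n} \<times> {0..<n}"]) (auto simp: cycle_graph_def)
  moreover have "[a = b + 1] (mod m) \<longleftrightarrow> [b = a - 1] (mod m)" for a b m :: int
    by (metis add_diff_cancel_right' cong_diff cong_add cong_refl cong_sym diff_add_cancel)
  ultimately show ?thesis
    by unfold_locales
      (auto simp: cycle_graph_def symmetric_def sym_def)
qed

lemma pair_graph_cartesian_product:
  assumes "pair_graph G" "pair_graph H"
  shows "pair_graph (G \<box> H)"
proof -
  interpret G: pair_graph G by fact
  interpret H: pair_graph H by fact
  have "finite (parcs (G \<box> H))"
    by (rule finite_subset[of _ "(pverts G \<times> pverts H) \<times> (pverts G \<times> pverts H)"])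
      (auto simp: cartesian_product_def)
  then show ?thesis
    using G.pair_sym_arcs H.pair_sym_arcs
    by unfold_locales
      (auto simp: cartesian_product_def symmetric_def sym_def G.pair_no_loops H.pair_no_loops
        dest: G.pair_no_loops H.pair_no_loops)
qed

text \<open>
  The minimum defining the radio number is taken over a nonempty set.
\<close>

lemma radio_labeling_exists:
  assumes "finite (pverts G)"
  shows "\<exists>c. radio_labeling G c"
proof -
  obtain f :: "'a \<Rightarrow> nat" where f: "inj_on f (pverts G)"
    using finite_imp_inj_to_nat_seg[OF assms] by blast
  let ?m = "1 + graph_diam G"
  have "int ?m \<le> \<bar>int (1 + f u * ?m) - int (1 + f v * ?m)\<bar>"
    if "u \<in> pverts G" "v \<in> pverts G" "u \<noteq> v" for u v
  proof -
    have "1 \<le> \<bar>int (f u) - int (f v)\<bar>"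
    proof -
      have "f u \<noteq> f v" using that f by (auto dest: inj_onD)
      then show ?thesis by linarith
    qed
    then have "1 * int ?m \<le> \<bar>int (f u) - int (f v)\<bar> * int ?m"
      by (intro mult_right_mono) auto
    also have "\<dots> = \<bar>(int (f u) - int (f v)) * int ?m\<bar>"
      by (simp add: abs_mult)
    finally show ?thesis by (simp add: algebra_simps)
  qed
  then have "radio_labeling G (\<lambda>v. 1 + f v * ?m)"
    unfolding radio_labeling_def by fastforce
  then show ?thesis by blast
qed

end

theory Submission
  imports Defs
begin

text \<open>
  The three cyclic distances among three vertices of \<open>C\<^sub>n\<close> add up to at most \<open>n\<close>, so the three
  distances among three vertices of the torus add up to at most \<open>2n\<close>. Since the diameter is at
  least \<open>2k\<close>, adding the three radio conditions shows that among any three vertices the largest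
  and the smallest label differ by at least \<open>k + 1\<close>. Sorting the \<open>n\<^sup>2\<close> vertices by label and going
  up two vertices at a time gives the bound.
\<close>

section \<open>Walks and distances in general graphs\<close>

text \<open>Relational powers make walks easy to build by induction and to concatenate with
  \<open>relpow_add\<close>. The conjunct \<open>u \<in> pverts G\<close> matters at
  \<open>l = 0\<close>: the zeroth power relates every element to itself, while a walk has to start
  at a vertex.\<close>

lemma relpow_parcs_iff_awalk:
  "u \<in> pverts G \<and> (u, v) \<in> parcs G ^^ l \<longleftrightarrow>
    (\<exists>p. pre_digraph.awalk (with_proj G) u p v \<and> length p = l)"
  if "pair_wf_digraph G"
proof (induction l arbitrary: u)
  case 0
  show ?case
    by (auto simp: pre_digraph.awalk_def pre_digraph.cas.simps)
next
  case (Suc l)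
  interpret pair_wf_digraph G by fact
  have "u \<in> pverts G \<and> (u, v) \<in> parcs G ^^ Suc l \<longleftrightarrow>
      (\<exists>x. (u, x) \<in> parcs G \<and> (x \<in> pverts G \<and> (x, v) \<in> parcs G ^^ l))"
    by (auto simp del: relpow.simps dest: in_arcsD1 in_arcsD2 relpow_Suc_D2 intro: relpow_Suc_I2)
  also have "\<dots> \<longleftrightarrow> (\<exists>p. awalk u p v \<and> length p = Suc l)"
    unfolding Suc.IH
  proof safe
    fix x p
    assume "(u, x) \<in> parcs G" "awalk x p v" "l = length p"
    then have "awalk u ((u, x) # p) v"
      by (auto simp: awalk_Cons_iff)
    then show "\<exists>q. awalk u q v \<and> length q = Suc (length p)"
      by (intro exI[of _ "(u, x) # p"]) simp
  next
    fix p
    assume p: "awalk u p v" "length p = Suc l"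
    then obtain e q where "p = e # q" by (cases p) auto
    with p have "(u, snd e) \<in> parcs G" "awalk (snd e) q v" "length q = l"
      by (cases e, simp add: awalk_Cons_iff)+
    then show "\<exists>x. (u, x) \<in> parcs G \<and> (\<exists>p. awalk x p v \<and> length p = l)"
      by blast
  qed
  finally show ?case .
qed

lemma graph_dist_le:
  assumes "pair_wf_digraph G" "u \<in> pverts G" "(u, v) \<in> parcs G ^^ l"
  shows "graph_dist G u v \<le> l"
  unfolding graph_dist_def relpow_parcs_iff_awalk[OF assms(1), symmetric]
  using assms by (intro Least_le) auto

text \<open>Any walk shows that the \<open>LEAST\<close> in the distance is attained. The shortest
  walk obtained this way turns a lower bound on all walk lengths into one on the distance.\<close>

lemma relpow_graph_dist:
  assumes "pair_wf_digraph G" "u \<in> pverts G" "(u, v) \<in> parcs G ^^ l"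
  shows "(u, v) \<in> parcs G ^^ graph_dist G u v"
  using LeastI_ex[of "\<lambda>l. u \<in> pverts G \<and> (u, v) \<in> parcs G ^^ l"] assms
  unfolding graph_dist_def relpow_parcs_iff_awalk[OF assms(1), symmetric]
  by auto

lemma graph_dist_le_graph_diam:
  assumes "finite (pverts G)" "u \<in> pverts G" "v \<in> pverts G"
  shows "graph_dist G u v \<le> graph_diam G"
  unfolding graph_diam_def
proof (rule Max_ge)
  have "{graph_dist G u v | u v. u \<in> pverts G \<and> v \<in> pverts G}
      = (\<lambda>(u, v). graph_dist G u v) ` (pverts G \<times> pverts G)"
    by auto
  then show "finite {graph_dist G u v | u v. u \<in> pverts G \<and> v \<in> pverts G}"
    using assms(1) by simp
qed (use assms in auto)

section \<open>Walks in Cartesian products\<close>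

lemma pverts_cartesian_product [simp]: "pverts (G \<box> H) = pverts G \<times> pverts H"
  by (simp add: cartesian_product_def)

lemma relpow_cartesian_product_fst:
  assumes "pair_wf_digraph G" "h \<in> pverts H" "(g, g') \<in> parcs G ^^ l"
  shows "((g, h), (g', h)) \<in> parcs (G \<box> H) ^^ l"
  using assms(3)
proof (induction l arbitrary: g')
  case (Suc l)
  then obtain x where x: "(g, x) \<in> parcs G ^^ l" "(x, g') \<in> parcs G"
    by auto
  interpret pair_wf_digraph G by fact
  have "((x, h), (g', h)) \<in> parcs (G \<box> H)"
    using x(2) assms(2) by (auto simp: cartesian_product_def dest: in_arcsD1 in_arcsD2)
  with Suc.IH[OF x(1)] show ?case by auto
qed auto

lemma relpow_cartesian_product_snd:
  assumes "pair_wf_digraph H" "g \<in> pverts G" "(h, h') \<in> parcs H ^^ l"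
  shows "((g, h), (g, h')) \<in> parcs (G \<box> H) ^^ l"
  using assms(3)
proof (induction l arbitrary: h')
  case (Suc l)
  then obtain x where x: "(h, x) \<in> parcs H ^^ l" "(x, h') \<in> parcs H"
    by auto
  interpret pair_wf_digraph H by fact
  have "((g, x), (g, h')) \<in> parcs (G \<box> H)"
    using x(2) assms(2) by (auto simp: cartesian_product_def dest: in_arcsD1 in_arcsD2)
  with Suc.IH[OF x(1)] show ?case by auto
qed auto

text \<open>Walk first in \<open>G\<close> with \<open>h\<close> fixed, then in \<open>H\<close>
  with \<open>g'\<close> fixed.\<close>

lemma relpow_cartesian_product:
  assumes "pair_wf_digraph G" "pair_wf_digraph H" "h \<in> pverts H" "g' \<in> pverts G"
    and "(g, g') \<in> parcs G ^^ l" "(h, h') \<in> parcs H ^^ m"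
  shows "((g, h), (g', h')) \<in> parcs (G \<box> H) ^^ (l + m)"
  using relpow_cartesian_product_fst[OF assms(1,3,5)] relpow_cartesian_product_snd[OF assms(2,4,6)]
  by (auto simp: relpow_add)

section \<open>Cyclic distance and walks in the cycle\<close>

text \<open>The length of the shorter of the two arcs between \<open>a\<close> and \<open>b\<close>;
  the difference of \<open>max\<close> and \<open>min\<close> is the absolute difference, safe under
  truncated subtraction.\<close>

definition cyclic_dist :: "nat \<Rightarrow> nat \<Rightarrow> nat \<Rightarrow> nat" where
  "cyclic_dist n a b = min (max a b - min a b) (n - (max a b - min a b))"

text \<open>For sorted vertices x, y, z, bound the inner pairs by the arcs y - x and z - y and the
  outer pair by the complementary arc n - (z - x): together these go around the cycle exactly once.
  Symmetry covers the other orders.\<close>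

lemma cyclic_dist_triple:
  assumes "a < n" "b < n" "c < n"
  shows "cyclic_dist n a b + cyclic_dist n b c + cyclic_dist n a c \<le> n"
proof -
  have sym: "cyclic_dist n x y = cyclic_dist n y x" for x y
    by (simp add: cyclic_dist_def max.commute min.commute)
  have le: "cyclic_dist n x y \<le> y - x" "cyclic_dist n x y \<le> n - (y - x)" if "x \<le> y" for x y
    using that by (simp_all add: cyclic_dist_def)
  have sorted: "cyclic_dist n x y + cyclic_dist n y z + cyclic_dist n x z \<le> n"
    if "x \<le> y" "y \<le> z" "z < n" for x y z
    using le(1)[of x y] le(1)[of y z] le(2)[of x z] that by linarith
  show ?thesis
    using sorted[of a b c] sorted[of a c b] sorted[of b a c] sorted[of b c a] sorted[of c a b]
      sorted[of c b a] sym[of a b] sym[of b c] sym[of a c] assms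
    by linarith
qed

lemma pverts_cycle_graph [simp]: "pverts (cycle_graph n) = {0..<n}"
  by (simp add: cycle_graph_def)

lemma parcs_cycle_graph_iff:
  "(v, w) \<in> parcs (cycle_graph n) \<longleftrightarrow> v < n \<and> w < n \<and> v \<noteq> w \<and>
    (v = w + 1 \<or> w = v + 1 \<or> v = 0 \<and> w = n - 1 \<or> w = 0 \<and> v = n - 1)"
proof -
  have *: "[int v = int w + 1] (mod int n) \<longleftrightarrow> v = w + 1 \<or> v = 0 \<and> w = n - 1"
    if "v < n" "w < n" for v w
  \<comment> \<open>Reduction modulo n changes w + 1 only at the wrap-around edge, where w + 1 =
    n.\<close>
  proof (cases "w = n - 1")
    case True
    then have "int w + 1 = int n" using that by simp
    then show ?thesis using that True by (auto simp: cong_def)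
  next
    case False
    then have "int w + 1 < int n" using that by simp
    then show ?thesis using that False by (auto simp: cong_def)
  qed
  have "[int v = int w - 1] (mod int n) \<longleftrightarrow> [int w = int v + 1] (mod int n)"
    by (metis add_diff_cancel_right' cong_diff cong_add cong_refl cong_sym diff_add_cancel)
  then show ?thesis
    using *[of v w] *[of w v] by (auto simp: cycle_graph_def)
qed

lemma pair_wf_digraph_cycle_graph: "pair_wf_digraph (cycle_graph n)"
  by unfold_locales (auto simp: parcs_cycle_graph_iff)

lemma relpow_cycle_graph_up:
  assumes "a + l < n"
  shows "(a, a + l) \<in> parcs (cycle_graph n) ^^ l"
  using assms
proof (induction l)
  case (Suc l)
  then have "(a + l, a + Suc l) \<in> parcs (cycle_graph n)"
    by (simp add: parcs_cycle_graph_iff)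
  with Suc show ?case by auto
qed auto

lemma relpow_cycle_graph_sym:
  assumes "(a, b) \<in> parcs (cycle_graph n) ^^ l"
  shows "(b, a) \<in> parcs (cycle_graph n) ^^ l"
  using assms
proof (induction l arbitrary: b)
  case (Suc l)
  then obtain x where x: "(a, x) \<in> parcs (cycle_graph n) ^^ l" "(x, b) \<in> parcs (cycle_graph n)"
    by auto
  then have "(b, x) \<in> parcs (cycle_graph n)"
    by (auto simp: parcs_cycle_graph_iff)
  with Suc.IH[OF x(1)] show ?case
    by (blast intro: relpow_Suc_I2)
qed auto

lemma relpow_cycle_graph:
  assumes "a < n" "b < n"
  shows "(a, b) \<in> parcs (cycle_graph n) ^^ cyclic_dist n a b"
proof -
  have *: "(a, b) \<in> parcs (cycle_graph n) ^^ cyclic_dist n a b" if "a \<le> b" "b < n" for a b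
  proof (cases "b - a \<le> n - (b - a)")
    case True
    then have "cyclic_dist n a b = b - a"
      using that by (simp add: cyclic_dist_def)
    then show ?thesis
      using relpow_cycle_graph_up[of a "b - a" n] that by simp
  next
    case False
    \<comment> \<open>The shorter arc passes through 0: descend from \<open>a\<close> to 0, cross to
      n - 1, descend to \<open>b\<close>. Its length is n - (b - a).\<close>
    have "(a, 0) \<in> parcs (cycle_graph n) ^^ a"
      using relpow_cycle_graph_up[of 0 a n] that by (auto intro: relpow_cycle_graph_sym)
    moreover have "(0, n - 1) \<in> parcs (cycle_graph n) ^^ 1"
      using that False by (auto simp: parcs_cycle_graph_iff)
    moreover have "(n - 1, b) \<in> parcs (cycle_graph n) ^^ (n - 1 - b)"
      using relpow_cycle_graph_up[of b "n - 1 - b" n] that by (auto intro: relpow_cycle_graph_sym)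
    ultimately have "(a, b) \<in> parcs (cycle_graph n) ^^ (a + 1 + (n - 1 - b))"
      unfolding relpow_add by blast
    moreover have "cyclic_dist n a b = a + 1 + (n - 1 - b)"
      using that False by (simp add: cyclic_dist_def)
    ultimately show ?thesis by simp
  qed
  show ?thesis
  proof (cases "a \<le> b")
    case True
    then show ?thesis using * assms by simp
  next
    case False
    moreover have "cyclic_dist n b a = cyclic_dist n a b"
      by (simp add: cyclic_dist_def max.commute min.commute)
    ultimately show ?thesis
      using *[of b a] assms by (auto intro: relpow_cycle_graph_sym)
  qed
qed

section \<open>Distances and diameter of the torus\<close>

lemma pair_wf_digraph_torus: "pair_wf_digraph (cycle_graph n \<box> cycle_graph n)"
proof -
  interpret pair_graph "cycle_graph n \<box> cycle_graph n"
    by (intro pair_graph_cartesian_product pair_graph_cycle_graph)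
  show ?thesis by unfold_locales
qed

lemma relpow_torus:
  assumes "u \<in> {0..<n} \<times> {0..<n}" "v \<in> {0..<n} \<times> {0..<n}"
  shows "(u, v) \<in> parcs (cycle_graph n \<box> cycle_graph n) ^^
    (cyclic_dist n (fst u) (fst v) + cyclic_dist n (snd u) (snd v))"
  using assms
    relpow_cartesian_product[OF pair_wf_digraph_cycle_graph pair_wf_digraph_cycle_graph _ _
      relpow_cycle_graph relpow_cycle_graph]
  by (cases u; cases v) auto

lemma graph_dist_torus_le:
  assumes "u \<in> {0..<n} \<times> {0..<n}" "v \<in> {0..<n} \<times> {0..<n}"
  shows "graph_dist (cycle_graph n \<box> cycle_graph n) u v
    \<le> cyclic_dist n (fst u) (fst v) + cyclic_dist n (snd u) (snd v)"
  using graph_dist_le[OF pair_wf_digraph_torus _ relpow_torus] assms by simp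

lemma graph_dist_torus_triple:
  fixes n :: nat
  defines "G \<equiv> cycle_graph n \<box> cycle_graph n"
  assumes "u \<in> pverts G" "v \<in> pverts G" "w \<in> pverts G"
  shows "graph_dist G u v + graph_dist G v w + graph_dist G u w \<le> 2 * n"
proof -
  have *: "u \<in> {0..<n} \<times> {0..<n}" "v \<in> {0..<n} \<times> {0..<n}" "w \<in> {0..<n} \<times> {0..<n}"
    using assms(2-4) by (simp_all add: G_def)
  then have "fst u < n" "fst v < n" "fst w < n" "snd u < n" "snd v < n" "snd w < n"
    by auto
  then show ?thesis
    using graph_dist_torus_le[OF *(1,2)] graph_dist_torus_le[OF *(2,3)]
      graph_dist_torus_le[OF *(1,3)]
      cyclic_dist_triple[of "fst u" n "fst v" "fst w"]
      cyclic_dist_triple[of "snd u" n "snd v" "snd w"]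
    unfolding G_def by linarith
qed

text \<open>An arc of the torus moves one coordinate along one edge of the cycle, which raises its
  cyclic distance from 0 by at most one. Walks from the origin are enough to bound the diameter from
  below.\<close>

lemma cyclic_dist_origin_le_relpow_torus:
  assumes "((0, 0), v) \<in> parcs (cycle_graph n \<box> cycle_graph n) ^^ l"
  shows "cyclic_dist n 0 (fst v) + cyclic_dist n 0 (snd v) \<le> l"
  using assms
proof (induction l arbitrary: v)
  case 0
  then show ?case by (auto simp: cyclic_dist_def)
next
  case (Suc l)
  then obtain x where x: "((0, 0), x) \<in> parcs (cycle_graph n \<box> cycle_graph n) ^^ l"
    and arc: "(x, v) \<in> parcs (cycle_graph n \<box> cycle_graph n)"
    by auto
  have step: "cyclic_dist n 0 b \<le> Suc (cyclic_dist n 0 a)"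
    if "(a, b) \<in> parcs (cycle_graph n)" for a b
    using that by (auto simp: parcs_cycle_graph_iff cyclic_dist_def)
  have "cyclic_dist n 0 (fst v) + cyclic_dist n 0 (snd v)
      \<le> Suc (cyclic_dist n 0 (fst x) + cyclic_dist n 0 (snd x))"
    using arc by (auto simp: cartesian_product_def dest: step)
  with Suc.IH[OF x] show ?case by simp
qed

lemma graph_diam_torus_ge:
  assumes "n = 2 * k + 1"
  shows "2 * k \<le> graph_diam (cycle_graph n \<box> cycle_graph n)"
proof -
  let ?G = "cycle_graph n \<box> cycle_graph n"
  have *: "(0, 0) \<in> {0..<n} \<times> {0..<n}" "(k, k) \<in> {0..<n} \<times> {0..<n}"
    using assms by auto
  \<comment> \<open>In a cycle of odd length 2k + 1, the vertex k is as far from 0 as possible, and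
    both coordinates attain this at once.\<close>
  have "2 * k = cyclic_dist n 0 k + cyclic_dist n 0 k"
    using assms by (simp add: cyclic_dist_def)
  also have "\<dots> \<le> graph_dist ?G (0, 0) (k, k)"
    using cyclic_dist_origin_le_relpow_torus[OF
        relpow_graph_dist[OF pair_wf_digraph_torus _ relpow_torus[OF *]]] *
    by simp
  also have "\<dots> \<le> graph_diam ?G"
    using * by (intro graph_dist_le_graph_diam) simp_all
  finally show ?thesis .
qed

section \<open>From gaps within triples to a large label\<close>

text \<open>Induction on \<open>m\<close>: remove two elements with the largest values. The rest
  contains some \<open>x\<close> of value at least \<open>b + m * d\<close>, and the triple of
  \<open>x\<close> and the two removed elements gains another \<open>d\<close>. The hypotheses on
  values pass to subsets.\<close>

lemma large_value_if_triples_spread: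
  fixes c :: "'a \<Rightarrow> nat"
  assumes "finite A" "card A = 2 * m + 1" "\<And>x. x \<in> A \<Longrightarrow> b \<le> c x"
    and "\<And>u v w. \<lbrakk>u \<in> A; v \<in> A; w \<in> A; u \<noteq> v; v \<noteq> w; u \<noteq> w; c u \<le> c v; c v \<le> c w\<rbrakk>
      \<Longrightarrow> c u + d \<le> c w"
  shows "\<exists>x\<in>A. b + m * d \<le> c x"
  using assms
proof (induction m arbitrary: A)
  case 0
  then have "A \<noteq> {}" by auto
  with 0 show ?case by auto
next
  case (Suc m)
  have maximum: "\<exists>w\<in>B. \<forall>x\<in>B. c x \<le> c w" if "finite B" "B \<noteq> {}" for B :: "'a set"
  proof -
    have "Max (c ` B) \<in> c ` B"
      using that by (intro Max_in) auto
    then obtain w where "w \<in> B" "Max (c ` B) = c w"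
      by auto
    moreover have "c x \<le> Max (c ` B)" if "x \<in> B" for x
      using that \<open>finite B\<close> by simp
    ultimately show ?thesis by metis
  qed
  have "A \<noteq> {}" using Suc.prems by auto
  then obtain w where w: "w \<in> A" "\<And>x. x \<in> A \<Longrightarrow> c x \<le> c w"
    using maximum[OF Suc.prems(1)] by metis
  have card: "card (A - {w}) = 2 * m + 2"
    using Suc.prems w by simp
  then have "A - {w} \<noteq> {}" by (intro notI) (simp only: card.empty)
  then obtain v where v: "v \<in> A - {w}" "\<And>x. x \<in> A - {w} \<Longrightarrow> c x \<le> c v"
    using maximum[OF finite_Diff[OF Suc.prems(1)]] by metis
  have "card (A - {w} - {v}) = 2 * m + 1"
    using Suc.prems(1) v card by simp
  then have "\<exists>x\<in>A - {w} - {v}. b + m * d \<le> c x"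
    using Suc.prems(1) by (intro Suc.IH Suc.prems(3,4)) simp_all
  then obtain x where x: "x \<in> A - {w} - {v}" "b + m * d \<le> c x"
    by blast
  then have "c x + d \<le> c w"
    using v(1) v(2)[of x] w(1) w(2)[of v] by (intro Suc.prems(4)[of x v w]) simp_all
  with x have "b + Suc m * d \<le> c w" by simp
  with w show ?case by blast
qed

theorem theorem2p6:
  fixes k n :: nat
  assumes "n = 2 * k + 1"
  shows "real (radio_number (cycle_graph n \<box> cycle_graph n))
    \<ge> ((real n)\<^sup>2 - 1) / 2 * (real k + 1) + 1"
proof -
  define G where "G = cycle_graph n \<box> cycle_graph n"
  \<comment> \<open>Chosen so that n^2 = (2k + 1)^2 = 2m + 1, that is, m = (n^2 - 1) / 2.\<close>
  define m where "m = 2 * k * (k + 1)"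
  have verts: "pverts G = {0..<n} \<times> {0..<n}"
    by (simp add: G_def)
  have fin: "finite (pverts G)"
    by (simp add: verts)
  have "\<exists>s c. radio_labeling G c \<and> label_span G c = s"
    using radio_labeling_exists[OF fin] by blast
  then obtain c where c: "radio_labeling G c" "label_span G c = radio_number G"
    using LeastI_ex[of "\<lambda>s. \<exists>c. radio_labeling G c \<and> label_span G c = s"]
    unfolding radio_number_def by blast
  have diam: "2 * k \<le> graph_diam G"
    using graph_diam_torus_ge[OF assms] by (simp add: G_def)
  have "\<exists>x\<in>pverts G. 1 + m * (k + 1) \<le> c x"
  proof (rule large_value_if_triples_spread)
    show "card (pverts G) = 2 * m + 1"
      by (simp add: verts card_cartesian_product assms m_def algebra_simps)
    \<comment> \<open>Labels start at 1, which gives the final summand 1 of the bound.\<close>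
    show "1 \<le> c x" if "x \<in> pverts G" for x
      using c that by (simp add: radio_labeling_def)
  next
    fix u v w
    assume uvw: "u \<in> pverts G" "v \<in> pverts G" "w \<in> pverts G" "u \<noteq> v" "v \<noteq> w" "u \<noteq> w"
      and le: "c u \<le> c v" "c v \<le> c w"
    have radio: "1 + int (graph_diam G) \<le> int (graph_dist G x y) + \<bar>int (c x) - int (c y)\<bar>"
      if "x \<in> pverts G" "y \<in> pverts G" "x \<noteq> y" for x y
      using c that by (simp add: radio_labeling_def)
    have "graph_dist G u v + graph_dist G v w + graph_dist G u w \<le> 2 * n"
      using graph_dist_torus_triple uvw by (simp add: G_def)
    \<comment> \<open>The three label differences add up to 2 (c w - c u), so 3 (2k + 1) \<le> 2n +
      2 (c w - c u). With n = 2k + 1 this gives 2 (c w - c u) \<ge> 2k + 1, and integrality rounds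
      the gap up to k + 1.\<close>
    then show "c u + (k + 1) \<le> c w"
      using radio[of u v] radio[of v w] radio[of u w] uvw le diam assms by linarith
  qed (fact fin)
  then have "1 + m * (k + 1) \<le> radio_number G"
    unfolding c(2)[symmetric] label_span_def
    using fin by (meson Max_ge finite_imageI imageI le_trans)
  then have "real (1 + m * (k + 1)) \<le> real (radio_number G)"
    by linarith
  moreover have "((real n)\<^sup>2 - 1) / 2 = real m"
    by (simp add: assms m_def power2_eq_square algebra_simps)
  ultimately show ?thesis
    unfolding G_def by (simp only: of_nat_add of_nat_mult of_nat_1 add.commute)
qed

end
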